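(* Let $\Lambda\subseteq\mathbb{Z}^n$ be a $k$-dimensional lattice with basis matrix $B$ (a $k\times n$ integer matrix). For indices $1\le i_1<\dots<i_k\le n$, let $B_{i_1,\dots,i_k}$ be the $k\times k$ submatrix of $B$ formed by columns $i_1,\dots,i_k$. Let $S=\mathrm{diag}(S_1,\dots,S_n)$ with nonzero real numbers $S_1,\dots,S_n$. Then $$\det\Lambda^\perp_S=\frac{|S_1\cdots S_n|}{\Omega}\cdot\sqrt{\sum_{1\le i_1<\dots<i_k\le n}\left(\frac{\det B_{i_1,\dots,i_k}}{S_{i_1}\cdots S_{i_k}}\right)^2},$$ where $\Omega$ is the greatest common divisor of all $k\times k$ minors of $B$.
   Context: For a lattice $\Lambda\subseteq\mathbb{Z}^n$, $E_\Lambda$ is the $\mathbb{Q}$-subspace of $\mathbb{Q}^n$ spanned by a basis of $\Lambda$ and the orthogonal lattice is $\Lambda^\perp=\mathbb{Z}^n\cap E_\Lambda^\perp$ (orthogonal complement for the standard inner product). For a lattice $\Gamma\subseteq\mathbb{R}^n$ (row vectors) and $T\in\mathrm{GL}_n(\mathbb{R})$, $\Gamma_T=\{\vec{x}T:\vec{x}\in\Gamma\}$; $\Lambda^\perp_S=(\Lambda^\perp)_S$. The determinant of a lattice with basis matrix $C$ is $\sqrt{\det(CC^t)}$ (the zero lattice has determinant $1$). *)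

theory Defs
  imports
    Complex_Main
    "Jordan_Normal_Form.VS_Connect"
    "Jordan_Normal_Form.DL_Rank"
    "Jordan_Normal_Form.DL_Submatrix"
begin

section \<open>Lattices and their basis matrices\<close>

text \<open>
  Basis vectors are the rows of the matrix, so the integer combinations \<open>x C\<close> of the rows
  appear as \<open>C\<^sup>T *\<^sub>v x\<close>. A matrix with no rows is a basis matrix of the zero lattice.
\<close>

definition is_basis_matrix :: "nat \<Rightarrow> real mat \<Rightarrow> real vec set \<Rightarrow> bool" where
  "is_basis_matrix n C \<Gamma> \<longleftrightarrow>
     dim_col C = n \<and>
     distinct (rows C) \<and>
     module.lin_indpt class_ring (module_vec TYPE(real) n) (set (rows C)) \<and>
     \<Gamma> = {C\<^sup>T *\<^sub>v map_vec real_of_int x | x. x \<in> carrier_vec (dim_row C)}"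

definition is_int_basis_matrix :: "nat \<Rightarrow> int mat \<Rightarrow> int vec set \<Rightarrow> bool" where
  "is_int_basis_matrix n B \<Lambda> \<longleftrightarrow>
     is_basis_matrix n (map_mat real_of_int B) (map_vec real_of_int ` \<Lambda>)"

text \<open>
  The values of the next two constants do not depend on the chosen basis matrix: see
  \<open>lattice_det_eq\<close> and \<open>rat_space_eq\<close> below.
\<close>

definition lattice_det :: "nat \<Rightarrow> real vec set \<Rightarrow> real" where
  "lattice_det n \<Gamma> = (let C = (SOME C. is_basis_matrix n C \<Gamma>) in sqrt (det (C * C\<^sup>T)))"

definition rat_space :: "nat \<Rightarrow> int vec set \<Rightarrow> rat vec set" where
  "rat_space n \<Lambda> =
     vec_space.row_space n (map_mat rat_of_int (SOME B. is_int_basis_matrix n B \<Lambda>))"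

definition orth_lattice :: "nat \<Rightarrow> int vec set \<Rightarrow> int vec set" where
  "orth_lattice n \<Lambda> =
     {x \<in> carrier_vec n.
        map_vec rat_of_int x \<in> vec_module.orthogonal_complement n (rat_space n \<Lambda>)}"

text \<open>The image of \<open>\<Gamma>\<close> under \<open>x \<mapsto> x T\<close> for row vectors \<open>x\<close>.\<close>

definition lattice_transform :: "real vec set \<Rightarrow> real mat \<Rightarrow> real vec set" where
  "lattice_transform \<Gamma> T = (\<lambda>x. T\<^sup>T *\<^sub>v x) ` \<Gamma>"

section \<open>Independence of the chosen basis matrix\<close>

lemma is_basis_matrix_kernel:
  assumes C: "is_basis_matrix n C \<Gamma>"
    and x: "x \<in> carrier_vec (dim_row C)" and 0: "C\<^sup>T *\<^sub>v x = 0\<^sub>v n"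
  shows "x = 0\<^sub>v (dim_row C)"
proof (rule ccontr)
  assume "x \<noteq> 0\<^sub>v (dim_row C)"
  moreover have "C\<^sup>T \<in> carrier_mat n (dim_row C)" "distinct (cols C\<^sup>T)"
    using C by (auto simp: is_basis_matrix_def)
  ultimately have "module.lin_dep class_ring (module_vec TYPE(real) n) (set (cols C\<^sup>T))"
    using vec_space.lin_depI x 0 by blast
  then show False using C by (simp add: is_basis_matrix_def)
qed

lemma is_basis_matrix_change:
  assumes C: "is_basis_matrix n C \<Gamma>" and D: "is_basis_matrix n D \<Gamma>"
    and Cc: "C \<in> carrier_mat k n" and Dc: "D \<in> carrier_mat l n"
  obtains U where "U \<in> carrier_mat k l" "C = map_mat real_of_int U * D"
proof -
  have Cd: "dim_row C = k" "dim_col C = n" and Dd: "dim_row D = l" "dim_col D = n"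
    using Cc Dc by auto
  have "\<exists>x \<in> carrier_vec l. row C i = D\<^sup>T *\<^sub>v map_vec real_of_int x"
    if i: "i < k" for i
  proof -
    have "map_vec real_of_int (unit_vec k i) = unit_vec k i"
      by (intro eq_vecI) (auto simp: unit_vec_def)
    moreover have "C\<^sup>T *\<^sub>v unit_vec k i = row C i"
      using i Cd by (intro eq_vecI) auto
    ultimately have "row C i \<in> \<Gamma>"
      using C unfolding is_basis_matrix_def
      by (metis (mono_tags, lifting) Cd(1) mem_Collect_eq unit_vec_carrier)
    then show ?thesis using D Dd unfolding is_basis_matrix_def by blast
  qed
  then obtain f where f: "\<And>i. i < k \<Longrightarrow> f i \<in> carrier_vec l"
      "\<And>i. i < k \<Longrightarrow> row C i = D\<^sup>T *\<^sub>v map_vec real_of_int (f i)"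
    by metis
  define U where "U = mat k l (\<lambda>(i, j). f i $ j)"
  have U: "U \<in> carrier_mat k l" by (simp add: U_def)
  have "C = map_mat real_of_int U * D"
  proof (rule eq_matI)
    fix i j assume "i < dim_row (map_mat real_of_int U * D)" "j < dim_col (map_mat real_of_int U * D)"
    then have ij: "i < k" "j < n" "j < dim_col D" "j < dim_col C"
      using U Dd Cd by auto
    have "row (map_mat real_of_int U) i = map_vec real_of_int (f i)"
      using f(1)[OF ij(1)] ij by (intro eq_vecI) (auto simp: U_def)
    moreover have "C $$ (i, j) = row C i $ j" using ij Cd by simp
    moreover have "\<dots> = col D j \<bullet> map_vec real_of_int (f i)"
      using f(2)[OF ij(1)] ij by simp
    moreover have "\<dots> = map_vec real_of_int (f i) \<bullet> col D j"
      using f(1)[OF ij(1)] Dd by (intro comm_scalar_prod[of _ l]) auto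
    ultimately show "C $$ (i, j) = (map_mat real_of_int U * D) $$ (i, j)"
      using ij U by simp
  qed (use U Cd Dd in auto)
  with U show thesis using that by blast
qed

lemma is_basis_matrix_left_cancel:
  assumes C: "is_basis_matrix n C \<Gamma>"
    and Cc: "C \<in> carrier_mat k n"
    and M: "M \<in> carrier_mat k k" and eq: "C = M * C"
  shows "M = 1\<^sub>m k"
proof -
  have Cd: "dim_row C = k" "dim_col C = n" using Cc by auto
  have *: "row M i = unit_vec k i" if i: "i < k" for i
  proof -
    let ?x = "row M i - unit_vec k i"
    have r: "row M i \<in> carrier_vec k" using M i by auto
    have "C\<^sup>T *\<^sub>v row M i = row C i"
    proof (rule eq_vecI)
      fix j assume "j < dim_vec (row C i)"
      then have j: "j < n" "j < dim_col C" using Cd by auto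
      have "(C\<^sup>T *\<^sub>v row M i) $ j = col C j \<bullet> row M i" using j Cd by simp
      also have "\<dots> = row M i \<bullet> col C j" using r j Cd by (intro comm_scalar_prod[of _ k]) auto
      also have "\<dots> = (M * C) $$ (i, j)" using i j M Cd by simp
      also have "\<dots> = row C i $ j" using i j Cd by (simp add: eq[symmetric])
      finally show "(C\<^sup>T *\<^sub>v row M i) $ j = row C i $ j" .
    qed (use Cd in auto)
    moreover have "C\<^sup>T *\<^sub>v unit_vec k i = row C i"
      using i Cd by (intro eq_vecI) auto
    moreover have "C\<^sup>T *\<^sub>v ?x = C\<^sup>T *\<^sub>v row M i - C\<^sup>T *\<^sub>v unit_vec k i"
      using Cc r by (intro mult_minus_distrib_mat_vec[of _ n k]) auto
    ultimately have "C\<^sup>T *\<^sub>v ?x = row C i - row C i" by (simp only:)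
    also have "\<dots> = 0\<^sub>v n" using Cc i by (intro minus_cancel_vec) auto
    finally have x0: "?x = 0\<^sub>v k"
      using is_basis_matrix_kernel[OF C, of ?x] r Cd by simp
    show ?thesis
    proof (rule eq_vecI)
      fix j assume "j < dim_vec (unit_vec k i :: real vec)"
      then have j: "j < k" by simp
      have "?x $ j = 0" using x0 j by simp
      then show "row M i $ j = unit_vec k i $ j" using j r by simp
    qed (use M in simp)
  qed
  show ?thesis
  proof (rule eq_rowI)
    fix i assume "i < dim_row (1\<^sub>m k :: real mat)"
    then show "row M i = row (1\<^sub>m k) i" using * by simp
  qed (use M in auto)
qed

lemma is_basis_matrix_unimodular:
  assumes C: "is_basis_matrix n C \<Gamma>" and D: "is_basis_matrix n D \<Gamma>"
    and Cc: "C \<in> carrier_mat k n" and Dc: "D \<in> carrier_mat l n"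
  obtains U V where
    "k = l" "U \<in> carrier_mat l l" "V \<in> carrier_mat l l"
    "C = map_mat real_of_int U * D" "U * V = 1\<^sub>m l"
proof -
  let ?R = "map_mat real_of_int"
  obtain U where U: "U \<in> carrier_mat k l" "C = ?R U * D"
    using is_basis_matrix_change[OF C D Cc Dc] .
  obtain V where V: "V \<in> carrier_mat l k" "D = ?R V * C"
    using is_basis_matrix_change[OF D C Dc Cc] .
  have RU: "?R U \<in> carrier_mat k l" and RV: "?R V \<in> carrier_mat l k" using U V by auto
  have "C = (?R U * ?R V) * C"
    using assoc_mult_mat[OF RU RV Cc] U(2) V(2) by argo
  then have UV: "?R U * ?R V = 1\<^sub>m k"
    using is_basis_matrix_left_cancel[OF C Cc] RU RV by (meson mult_carrier_mat)
  have "D = (?R V * ?R U) * D"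
    using assoc_mult_mat[OF RV RU Dc] U(2) V(2) by argo
  then have VU: "?R V * ?R U = 1\<^sub>m l"
    using is_basis_matrix_left_cancel[OF D Dc] RU RV by (meson mult_carrier_mat)
  have "real k = (\<Sum>i<k. (?R U * ?R V) $$ (i, i))" by (simp add: UV)
  also have "\<dots> = (\<Sum>i<k. \<Sum>j<l. ?R U $$ (i, j) * ?R V $$ (j, i))"
    using RU RV by (intro sum.cong) (auto simp: scalar_prod_def atLeast0LessThan)
  also have "\<dots> = (\<Sum>j<l. \<Sum>i<k. ?R V $$ (j, i) * ?R U $$ (i, j))"
    by (subst sum.swap) (simp add: mult.commute)
  also have "\<dots> = (\<Sum>j<l. (?R V * ?R U) $$ (j, j))"
    using RU RV by (intro sum.cong) (auto simp: scalar_prod_def atLeast0LessThan)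
  also have "\<dots> = real l" by (simp add: VU)
  finally have kl: "k = l" by simp
  have "?R (U * V) = ?R (1\<^sub>m k)"
    by (simp only: of_int_hom.mat_hom_mult[OF U(1) V(1)] UV of_int_hom.mat_hom_one)
  then have "U * V = 1\<^sub>m k" by (rule of_int_hom.mat_hom_inj)
  then show thesis using that[OF kl, of U V] U V(1) unfolding kl by blast
qed

lemma lattice_det_eq:
  assumes C: "is_basis_matrix n C \<Gamma>"
  shows "lattice_det n \<Gamma> = sqrt (det (C * C\<^sup>T))"
proof -
  define D where "D = (SOME C. is_basis_matrix n C \<Gamma>)"
  have D: "is_basis_matrix n D \<Gamma>" unfolding D_def using C by (rule someI)
  define k l where "k = dim_row C" and "l = dim_row D"
  have Cc: "C \<in> carrier_mat k n" and Dc: "D \<in> carrier_mat l n"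
    using C D by (auto simp: is_basis_matrix_def k_def l_def)
  let ?R = "map_mat real_of_int"
  obtain U V where UV: "k = l" "U \<in> carrier_mat l l" "V \<in> carrier_mat l l"
    "C = ?R U * D" "U * V = 1\<^sub>m l"
    using is_basis_matrix_unimodular[OF C D Cc Dc] .
  have RU: "?R U \<in> carrier_mat l l" using UV by auto
  have "det U * det V = 1" using det_mult[OF UV(2,3)] UV(5) by simp
  then have "det U * det U = 1"
    using zmult_eq_1_iff by auto
  then have one: "det (?R U) * det (?R U) = 1"
    by (metis of_int_1 of_int_hom.hom_det of_int_mult)
  have "C * C\<^sup>T = (?R U * D) * (D\<^sup>T * (?R U)\<^sup>T)"
    using UV(4) transpose_mult[OF RU Dc] by simp
  also have "\<dots> = ?R U * (D * D\<^sup>T) * (?R U)\<^sup>T"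
  proof -
    have Dt: "D\<^sup>T \<in> carrier_mat n l" and Ut: "(?R U)\<^sup>T \<in> carrier_mat l l" using Dc RU by auto
    show ?thesis
      using assoc_mult_mat[OF mult_carrier_mat[OF RU Dc] Dt Ut] assoc_mult_mat[OF RU Dc Dt] by simp
  qed
  finally have "det (C * C\<^sup>T) = det (?R U) * det (D * D\<^sup>T) * det (?R U)\<^sup>T"
    using RU Dc by (simp add: det_mult[of _ l])
  also have "\<dots> = (det (?R U) * det (?R U)) * det (D * D\<^sup>T)"
    using det_transpose[OF RU] by (simp only: mult_ac)
  also have "\<dots> = det (D * D\<^sup>T)" by (simp only: one mult_1)
  finally show ?thesis by (simp add: lattice_det_def Let_def D_def)
qed

lemma row_space_mult_subset:
  fixes A :: "'a :: field mat"
  assumes P: "P \<in> carrier_mat m l" and A: "A \<in> carrier_mat l n"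
  shows "vec_space.row_space n (P * A) \<subseteq> vec_space.row_space n A"
proof
  fix w assume w: "w \<in> vec_space.row_space n (P * A)"
  have PA: "P * A \<in> carrier_mat m n" using P A by simp
  from w obtain y where y: "y \<in> carrier_vec m" "(P * A)\<^sup>T *\<^sub>v y = w" "w \<in> carrier_vec n"
    using vec_space.row_space_eq[OF PA] P A by auto
  have "w = A\<^sup>T *\<^sub>v (P\<^sup>T *\<^sub>v y)"
    using y transpose_mult[OF P A] assoc_mult_mat_vec[of "A\<^sup>T" n l "P\<^sup>T" m y] P A by simp
  moreover have "P\<^sup>T *\<^sub>v y \<in> carrier_vec l"
    using P y(1) by (intro mult_mat_vec_carrier[of _ l m]) auto
  ultimately show "w \<in> vec_space.row_space n A"
    using vec_space.row_space_eq[OF A] y(3) A by auto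
qed

lemma rat_space_eq:
  assumes B: "is_int_basis_matrix n B \<Lambda>"
  shows "rat_space n \<Lambda> = vec_space.row_space n (map_mat rat_of_int B)"
proof -
  have sub: "vec_space.row_space n (map_mat rat_of_int B1) \<subseteq> vec_space.row_space n (map_mat rat_of_int B2)"
    if B12: "is_int_basis_matrix n B1 \<Lambda>" "is_int_basis_matrix n B2 \<Lambda>" for B1 B2
  proof -
    define k l where "k = dim_row B1" and "l = dim_row B2"
    have B1: "B1 \<in> carrier_mat k n" and B2: "B2 \<in> carrier_mat l n"
      using B12 by (auto simp: is_int_basis_matrix_def is_basis_matrix_def k_def l_def)
    have "map_mat real_of_int B1 \<in> carrier_mat k n" "map_mat real_of_int B2 \<in> carrier_mat l n"
      using B1 B2 by auto
    then obtain U where U: "U \<in> carrier_mat k l"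
      "map_mat real_of_int B1 = map_mat real_of_int U * map_mat real_of_int B2"
      using is_basis_matrix_change[OF B12[unfolded is_int_basis_matrix_def]] by blast
    have "map_mat real_of_int B1 = map_mat real_of_int (U * B2)"
      using U(2) of_int_hom.mat_hom_mult[OF U(1) B2] by metis
    then have "B1 = U * B2" by (rule of_int_hom.mat_hom_inj)
    then have "map_mat rat_of_int B1 = map_mat rat_of_int U * map_mat rat_of_int B2"
      using of_int_hom.mat_hom_mult[OF U(1) B2] by metis
    then show ?thesis
      using row_space_mult_subset[of "map_mat rat_of_int U" k l "map_mat rat_of_int B2" n] U(1) B2
      by simp
  qed
  have "is_int_basis_matrix n (SOME B. is_int_basis_matrix n B \<Lambda>) \<Lambda>" using B by (rule someI)
  with B show ?thesis unfolding rat_space_def by (intro equalityI sub)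
qed

end

theory Submission
  imports Defs
begin

text \<open>
  Integer row reduction gives a unimodular \<open>V\<close> with \<open>B V = [H | 0]\<close>, so with
  \<open>W = V\<^sup>-\<^sup>1\<close> and \<open>W\<^sub>1\<close> its first \<open>k\<close> rows, \<open>B = H W\<^sub>1\<close>. The last \<open>n - k\<close> columns
  \<open>V\<^sub>2\<close> of \<open>V\<close> then form a basis of the orthogonal lattice, and the Cauchy-Binet formula for
  \<open>W\<^sub>1 V\<^sub>1 = 1\<close> shows that the minors of \<open>W\<^sub>1\<close> are coprime, whence \<open>\<Omega> = |det H|\<close>.
  Put \<open>X = S V\<close> and \<open>Y = X\<^sup>-\<^sup>1 = W S\<^sup>-\<^sup>1\<close>. Jacobi's identity for complementary blocks of the
  inverse matrices \<open>X\<^sup>T X\<close> and \<open>Y Y\<^sup>T\<close> gives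
  \<open>det (X\<^sub>2\<^sup>T X\<^sub>2) = (det X)\<^sup>2 det (Y\<^sub>1 Y\<^sub>1\<^sup>T)\<close>, and by Cauchy-Binet
  \<open>(det H)\<^sup>2 det (Y\<^sub>1 Y\<^sub>1\<^sup>T) = det (B S\<^sup>-\<^sup>2 B\<^sup>T)\<close> is the sum of the squared weighted minors.
\<close>

section \<open>The Cauchy-Binet formula\<close>

text \<open>\<open>pick I\<close> enumerates \<open>I\<close> in increasing order, so its inverse
  sends an element to the number of smaller elements of \<open>I\<close>.\<close>

lemma bij_betw_pick:
  assumes "finite I"
  shows "bij_betw (pick I) {0..<card I} I"
proof (rule bij_betwI[where g = "\<lambda>i. card {a \<in> I. a < i}"])
  show "pick I \<in> {0..<card I} \<rightarrow> I" by (auto intro: pick_in_set)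
  show "(\<lambda>i. card {a \<in> I. a < i}) \<in> I \<rightarrow> {0..<card I}"
    using assms by (auto intro!: psubset_card_mono)
qed (auto simp: card_pick pick_card_in_set)

lemma submatrix_UNIV_left:
  assumes "A \<in> carrier_mat k n" "I \<subseteq> {..<n}"
  shows "submatrix A UNIV I = mat k (card I) (\<lambda>(i, j). A $$ (i, pick I j))"
proof -
  have "{j. j < n \<and> j \<in> I} = I" using assms by auto
  then show ?thesis using assms by (simp add: submatrix_def pick_UNIV)
qed

lemma submatrix_UNIV_right:
  assumes "A \<in> carrier_mat n k" "I \<subseteq> {..<n}"
  shows "submatrix A I UNIV = mat (card I) k (\<lambda>(i, j). A $$ (pick I i, j))"
proof -
  have "{j. j < n \<and> j \<in> I} = I" using assms by auto
  then show ?thesis using assms by (simp add: submatrix_def pick_UNIV)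
qed

text \<open>Each entry of the product is a sum over an inner index. Distributing the Leibniz product
  over these sums chooses one inner index \<open>f i\<close> per row; for fixed \<open>f\<close> the
  sum over permutations is the Leibniz expansion for the rows of \<open>B\<close> selected by
  \<open>f\<close>.\<close>

lemma det_mult_sum_funcset:
  fixes A B :: "'a :: comm_ring_1 mat"
  assumes A: "A \<in> carrier_mat k n" and B: "B \<in> carrier_mat n k"
  shows "det (A * B) = (\<Sum>f \<in> {0..<k} \<rightarrow>\<^sub>E {0..<n}.
           (\<Prod>i = 0..<k. A $$ (i, f i)) * det (mat k k (\<lambda>(i, j). B $$ (f i, j))))"
proof -
  let ?P = "{p. p permutes {0..<k}}" and ?F = "{0..<k} \<rightarrow>\<^sub>E {0..<n}"
  have "(\<Prod>i = 0..<k. (A * B) $$ (i, p i)) =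
      (\<Sum>f \<in> ?F. (\<Prod>i = 0..<k. A $$ (i, f i)) * (\<Prod>i = 0..<k. B $$ (f i, p i)))"
    if p: "p permutes {0..<k}" for p
  proof -
    have "(\<Prod>i = 0..<k. (A * B) $$ (i, p i)) = (\<Prod>i = 0..<k. \<Sum>j = 0..<n. A $$ (i, j) * B $$ (j, p i))"
      using A B permutes_in_image[OF p]
      by (intro prod.cong) (auto simp: scalar_prod_def)
    also have "\<dots> = (\<Sum>f \<in> ?F. \<Prod>i = 0..<k. A $$ (i, f i) * B $$ (f i, p i))"
      by (rule prod_sum_PiE) auto
    finally show ?thesis by (simp only: prod.distrib)
  qed
  then have "det (A * B) = (\<Sum>p \<in> ?P. \<Sum>f \<in> ?F. signof p *
      ((\<Prod>i = 0..<k. A $$ (i, f i)) * (\<Prod>i = 0..<k. B $$ (f i, p i))))"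
    using A B by (subst det_def'[of _ k]) (auto simp: sum_distrib_left intro!: sum.cong)
  also have "\<dots> = (\<Sum>f \<in> ?F. \<Sum>p \<in> ?P. (\<Prod>i = 0..<k. A $$ (i, f i)) *
      (signof p * (\<Prod>i = 0..<k. B $$ (f i, p i))))"
    by (subst sum.swap) (simp only: mult.left_commute)
  also have "\<dots> = (\<Sum>f \<in> ?F. (\<Prod>i = 0..<k. A $$ (i, f i)) * det (mat k k (\<lambda>(i, j). B $$ (f i, j))))"
  proof (rule sum.cong[OF refl])
    fix f
    have "(\<Prod>i = 0..<k. mat k k (\<lambda>(i, j). B $$ (f i, j)) $$ (i, p i)) = (\<Prod>i = 0..<k. B $$ (f i, p i))"
      if "p \<in> ?P" for p
      using that permutes_in_image[of p "{0..<k}"] by (intro prod.cong) auto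
    then show "(\<Sum>p \<in> ?P. (\<Prod>i = 0..<k. A $$ (i, f i)) * (signof p * (\<Prod>i = 0..<k. B $$ (f i, p i)))) =
        (\<Prod>i = 0..<k. A $$ (i, f i)) * det (mat k k (\<lambda>(i, j). B $$ (f i, j)))"
      by (subst det_def'[of _ k]) (auto simp: sum_distrib_left intro!: sum.cong)
  qed
  finally show ?thesis .
qed

text \<open>In the expansion over all \<open>f\<close>, a non-injective \<open>f\<close> repeats a
  row of \<open>B\<close> and contributes zero. The injective ones are grouped by their image
  \<open>I\<close>: each is \<open>pick I\<close> after a permutation \<open>p\<close>. Undoing
  \<open>p\<close> in the rows of the \<open>B\<close>-minor costs a sign, and these signs turn the
  remaining products into the Leibniz expansion of the \<open>A\<close>-minor.\<close>

lemma cauchy_binet: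
  fixes A B :: "'a :: comm_ring_1 mat"
  assumes A: "A \<in> carrier_mat k n" and B: "B \<in> carrier_mat n k"
  shows "det (A * B) = (\<Sum>I | I \<subseteq> {..<n} \<and> card I = k.
           det (submatrix A UNIV I) * det (submatrix B I UNIV))"
proof -
  let ?K = "{0..<k}" and ?S = "{I. I \<subseteq> {..<n} \<and> card I = k}"
  let ?g = "\<lambda>f. (\<Prod>i = 0..<k. A $$ (i, f i)) * det (mat k k (\<lambda>(i, j). B $$ (f i, j)))"
  let ?F = "{f \<in> ?K \<rightarrow>\<^sub>E {0..<n}. inj_on f ?K}"
  have fin: "finite (?K \<rightarrow>\<^sub>E {0..<n})" by (intro finite_PiE) auto
  have zero: "?g f = 0" if noninj: "\<not> inj_on f ?K" for f
  proof -
    from noninj obtain i j where ij: "i < k" "j < k" "i \<noteq> j" "f i = f j"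
      by (auto simp: inj_on_def)
    then have "det (mat k k (\<lambda>(i, j). B $$ (f i, j))) = 0"
      by (intro det_identical_rows[of _ k i j]) auto
    then show ?thesis by simp
  qed
  have "det (A * B) = sum ?g (?K \<rightarrow>\<^sub>E {0..<n})"
    by (rule det_mult_sum_funcset[OF A B])
  also have "\<dots> = sum ?g ?F"
    using fin zero by (intro sum.mono_neutral_right) auto
  also have "\<dots> = (\<Sum>I \<in> ?S. \<Sum>f | f \<in> ?F \<and> f ` ?K = I. ?g f)"
  proof (rule sum.group[symmetric])
    show "finite ?F" using fin by (rule rev_finite_subset) auto
    show "(\<lambda>f. f ` ?K) ` ?F \<subseteq> ?S" by (auto simp: card_image PiE_iff)
  qed auto
  also have "\<dots> = (\<Sum>I \<in> ?S. det (submatrix A UNIV I) * det (submatrix B I UNIV))"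
  proof (rule sum.cong[OF refl])
    fix I assume "I \<in> ?S"
    then have I: "I \<subseteq> {..<n}" "card I = k" by auto
    then have finI: "finite I" using finite_subset by blast
    let ?ix = "\<lambda>i. card {a \<in> I. a < i}"
    \<comment> \<open>These translate between permutations and injections with image
      \<open>I\<close>. Outside \<open>?K\<close> the two sides have different defaults:
      \<open>permutes\<close> demands the identity there, the extensional function space demands
      \<open>undefined\<close>.\<close>
    let ?pk = "\<lambda>p. \<lambda>i\<in>?K. pick I (p i)" and ?un = "\<lambda>f i. if i < k then ?ix (f i) else i"
    have bij: "bij_betw (pick I) ?K I" using bij_betw_pick[OF finI] I by simp
    have pk: "pick I j \<in> I" "pick I j < n" "?ix (pick I j) = j" if "j < k" for j
      using pick_in_set[of j I] card_pick[of j I] that I by auto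
    have ix: "?ix i < k" "pick I (?ix i) = i" if "i \<in> I" for i
      using that finI I(2) by (auto simp: pick_card_in_set intro!: psubset_card_mono)
    have BI: "submatrix B I UNIV = mat k k (\<lambda>(i, j). B $$ (pick I i, j))"
      and AI: "submatrix A UNIV I = mat k k (\<lambda>(i, j). A $$ (i, pick I j))"
      using submatrix_UNIV_left[OF A I(1)] submatrix_UNIV_right[OF B I(1)] I(2) by auto
    have "(\<Sum>f | f \<in> ?F \<and> f ` ?K = I. ?g f) = (\<Sum>p | p permutes ?K. ?g (?pk p))"
    proof (rule sum.reindex_bij_witness[where j = ?un and i = ?pk])
      fix f assume "f \<in> {f. f \<in> ?F \<and> f ` ?K = I}"
      then have f: "f \<in> ?K \<rightarrow>\<^sub>E {0..<n}" "inj_on f ?K" "f ` ?K = I" by auto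
      then have fI: "f i \<in> I" if "i < k" for i using that by auto
      show eq: "?pk (?un f) = f"
        using f(1) fI ix by (intro ext) (auto simp: PiE_iff extensional_def)
      have "inj_on (?un f) ?K"
      proof (rule inj_onI)
        fix x y assume xy: "x \<in> ?K" "y \<in> ?K" "?un f x = ?un f y"
        then have "pick I (?ix (f x)) = pick I (?ix (f y))" by simp
        then have "f x = f y" using ix(2)[OF fI[of x]] ix(2)[OF fI[of y]] xy(1,2) by auto
        then show "x = y" using f(2) xy by (simp add: inj_on_def)
      qed
      moreover have "?un f ` ?K \<subseteq> ?K" using fI ix by auto
      ultimately have "bij_betw (?un f) ?K ?K"
        using endo_inj_surj[of ?K "?un f"] by (simp add: bij_betw_def)
      then show "?un f \<in> {p. p permutes ?K}"
        by (auto intro!: bij_imp_permutes)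
      show "?g (?pk (?un f)) = ?g f" unfolding eq ..
    next
      fix p assume "p \<in> {p. p permutes ?K}"
      then have p: "p permutes ?K" by simp
      then have pK: "p i < k \<longleftrightarrow> i < k" for i using permutes_in_image[OF p, of i] by auto
      show "?un (?pk p) = p"
        using pk pK permutes_not_in[OF p] by (intro ext) auto
      have b: "bij_betw (\<lambda>i. pick I (p i)) ?K I"
        using bij_betw_trans[OF permutes_imp_bij[OF p] bij] by (simp add: o_def)
      then have "inj_on (?pk p) ?K" "?pk p ` ?K = I"
        by (auto simp: bij_betw_def inj_on_def image_def)
      then show "?pk p \<in> {f. f \<in> ?F \<and> f ` ?K = I}"
        using pk pK by auto
    qed
    also have "\<dots> = (\<Sum>p | p permutes ?K.
        signof p * (\<Prod>i = 0..<k. A $$ (i, pick I (p i))) * det (submatrix B I UNIV))"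
    proof (rule sum.cong[OF refl])
      fix p assume "p \<in> {p. p permutes ?K}"
      then have p: "p permutes ?K" by simp
      then have pK: "p i < k \<longleftrightarrow> i < k" for i using permutes_in_image[OF p, of i] by auto
      have "mat k k (\<lambda>(i, j). B $$ (?pk p i, j)) =
          mat k k (\<lambda>(i, j). submatrix B I UNIV $$ (p i, j))"
        using pK by (intro eq_matI) (auto simp: BI)
      then have "det (mat k k (\<lambda>(i, j). B $$ (?pk p i, j))) = signof p * det (submatrix B I UNIV)"
        using det_permute_rows[OF _ p, of "submatrix B I UNIV"] BI by simp
      then show "?g (?pk p) =
          signof p * (\<Prod>i = 0..<k. A $$ (i, pick I (p i))) * det (submatrix B I UNIV)"
        by (simp add: mult_ac)
    qed
    also have "\<dots> = (\<Sum>p | p permutes ?K.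
        signof p * (\<Prod>i = 0..<k. A $$ (i, pick I (p i)))) * det (submatrix B I UNIV)"
      by (simp only: sum_distrib_right)
    also have "(\<Sum>p | p permutes ?K. signof p * (\<Prod>i = 0..<k. A $$ (i, pick I (p i)))) =
        det (submatrix A UNIV I)"
    proof -
      have "(\<Prod>i = 0..<k. submatrix A UNIV I $$ (i, p i)) = (\<Prod>i = 0..<k. A $$ (i, pick I (p i)))"
        if "p permutes ?K" for p
        using permutes_in_image[OF that] by (intro prod.cong) (auto simp: AI)
      then show ?thesis
        using det_def'[of "submatrix A UNIV I" k] AI by simp
    qed
    finally show "(\<Sum>f | f \<in> ?F \<and> f ` ?K = I. ?g f) =
        det (submatrix A UNIV I) * det (submatrix B I UNIV)" .
  qed
  finally show ?thesis .
qed

section \<open>Unimodular reduction of integer matrices\<close>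

text \<open>Euclid's algorithm on the entries of column \<open>c\<close> in the rows from
  \<open>c\<close> on, with the sum of their absolute values as measure. All operations combine only
  those rows, so the rows above stay fixed and a column vanishing on those rows keeps vanishing; the
  last two clauses record this so that columns can be cleared one after another.\<close>

lemma unimodular_column_step:
  fixes A :: "int mat"
  assumes "A \<in> carrier_mat n k" and c: "c < n" "c < k"
  shows "\<exists>U \<in> carrier_mat n n. \<bar>det U\<bar> = 1 \<and>
    (\<forall>j. c < j \<longrightarrow> j < n \<longrightarrow> (U * A) $$ (j, c) = 0) \<and>
    (\<forall>j < c. \<forall>i < k. (U * A) $$ (j, i) = A $$ (j, i)) \<and>
    (\<forall>i < k. (\<forall>j \<in> {c..<n}. A $$ (j, i) = 0) \<longrightarrow> (\<forall>j \<in> {c..<n}. (U * A) $$ (j, i) = 0))"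
  using assms(1)
proof (induction "nat (\<Sum>j = c..<n. \<bar>A $$ (j, c)\<bar>)" arbitrary: A rule: less_induct)
  case (less A)
  note A = less.prems
  have dim: "dim_row A = n" "dim_col A = k" using A by auto
  \<comment> \<open>Either nothing is left below the diagonal, or two nonzero entries allow a
    Euclidean step, or the only nonzero entry sits below the diagonal and has to be swapped
    up.\<close>
  consider (reduced) "\<forall>j. c < j \<longrightarrow> j < n \<longrightarrow> A $$ (j, c) = 0"
    | (reduce) i j where "i \<in> {c..<n}" "j \<in> {c..<n}" "i \<noteq> j" "A $$ (j, c) \<noteq> 0"
        "\<bar>A $$ (j, c)\<bar> \<le> \<bar>A $$ (i, c)\<bar>"
    | (swap) p where "c < p" "p < n" "\<forall>j \<in> {c..<n}. j \<noteq> p \<longrightarrow> A $$ (j, c) = 0"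
  proof (cases "\<exists>p. c < p \<and> p < n \<and> A $$ (p, c) \<noteq> 0")
    case True
    then obtain p where p: "c < p" "p < n" "A $$ (p, c) \<noteq> 0" by blast
    show thesis
    proof (cases "\<exists>q \<in> {c..<n}. q \<noteq> p \<and> A $$ (q, c) \<noteq> 0")
      case True
      then obtain q where "q \<in> {c..<n}" "q \<noteq> p" "A $$ (q, c) \<noteq> 0" by blast
      then show thesis using reduce[of q p] reduce[of p q] p by fastforce
    qed (use p swap in blast)
  qed (use reduced in blast)
  then show ?case
  proof cases
    case reduced
    then show ?thesis using A by (intro bexI[of _ "1\<^sub>m n"]) auto
  next
    case (reduce i j)
    \<comment> \<open>Adding or subtracting a single copy of row \<open>j\<close> suffices: with
      these signs the absolute value of the entry in row \<open>i\<close> drops by exactly that of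
      the entry in row \<open>j\<close>.\<close>
    define a where "a = - (sgn (A $$ (i, c)) * sgn (A $$ (j, c)))"
    define A' where "A' = addrow a i j A"
    have A': "A' \<in> carrier_mat n k" using A by (simp add: A'_def)
    have eq: "A' = addrow_mat n a i j * A"
      using addrow_mat[OF A, of j] reduce by (simp add: A'_def)
    have "\<bar>a * A $$ (j, c) + A $$ (i, c)\<bar> < \<bar>A $$ (i, c)\<bar>"
      using reduce by (auto simp: a_def sgn_if)
    then have lt: "\<bar>A' $$ (i, c)\<bar> < \<bar>A $$ (i, c)\<bar>"
      using reduce c dim by (simp add: A'_def)
    have "(\<Sum>l = c..<n. \<bar>A' $$ (l, c)\<bar>) < (\<Sum>l = c..<n. \<bar>A $$ (l, c)\<bar>)"
    proof (rule sum_strict_mono_ex1)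
      show "\<forall>l \<in> {c..<n}. \<bar>A' $$ (l, c)\<bar> \<le> \<bar>A $$ (l, c)\<bar>"
      proof
        fix l assume l: "l \<in> {c..<n}"
        show "\<bar>A' $$ (l, c)\<bar> \<le> \<bar>A $$ (l, c)\<bar>"
          using l lt c dim by (cases "l = i") (auto simp: A'_def)
      qed
    qed (use reduce lt in auto)
    moreover have "0 \<le> (\<Sum>l = c..<n. \<bar>A' $$ (l, c)\<bar>)" by (intro sum_nonneg) auto
    ultimately have "nat (\<Sum>l = c..<n. \<bar>A' $$ (l, c)\<bar>) < nat (\<Sum>l = c..<n. \<bar>A $$ (l, c)\<bar>)"
      by linarith
    from less.hyps[OF this A'] obtain U where U: "U \<in> carrier_mat n n" "\<bar>det U\<bar> = 1"
      "\<forall>j. c < j \<longrightarrow> j < n \<longrightarrow> (U * A') $$ (j, c) = 0"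
      "\<forall>j < c. \<forall>i < k. (U * A') $$ (j, i) = A' $$ (j, i)"
      "\<forall>i < k. (\<forall>j \<in> {c..<n}. A' $$ (j, i) = 0) \<longrightarrow> (\<forall>j \<in> {c..<n}. (U * A') $$ (j, i) = 0)"
      by blast
    have UA: "U * A' = (U * addrow_mat n a i j) * A"
      unfolding eq using U(1) A by (intro assoc_mult_mat[symmetric]) auto
    have "\<bar>det (U * addrow_mat n a i j)\<bar> = 1"
      using U(1,2) det_addrow_mat[OF reduce(3), of n a] by (subst det_mult[of _ n]) auto
    moreover have "\<forall>j < c. \<forall>i < k. A' $$ (j, i) = A $$ (j, i)"
      using reduce c dim by (auto simp: A'_def)
    moreover have "\<forall>l < k. (\<forall>j \<in> {c..<n}. A $$ (j, l) = 0) \<longrightarrow> (\<forall>j \<in> {c..<n}. A' $$ (j, l) = 0)"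
      using reduce c dim by (auto simp: A'_def)
    ultimately show ?thesis
      using U unfolding UA by (intro bexI[of _ "U * addrow_mat n a i j"]) auto
  next
    case (swap p)
    have eq: "swaprows_mat n c p * A = swaprows c p A"
      using swaprows_mat[OF A, of c p] swap c by simp
    have "det (swaprows_mat n c p :: int mat) = - 1"
      using swap c by (intro det_swaprows_mat) auto
    then show ?thesis
      by (intro bexI[of _ "swaprows_mat n c p"]) (use swap c dim in \<open>auto simp: eq\<close>)
  qed
qed

text \<open>The columns are cleared from left to right, composing the unimodular matrices of the
  single steps.\<close>

lemma unimodular_row_reduction:
  fixes A :: "int mat"
  assumes A: "A \<in> carrier_mat n k"
  shows "\<exists>U \<in> carrier_mat n n. \<bar>det U\<bar> = 1 \<and> (\<forall>i < k. \<forall>j < n. i < j \<longrightarrow> (U * A) $$ (j, i) = 0)"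
proof -
  have "c \<le> k \<Longrightarrow> \<exists>U \<in> carrier_mat n n. \<bar>det U\<bar> = 1 \<and>
      (\<forall>i < c. \<forall>j < n. i < j \<longrightarrow> (U * A) $$ (j, i) = 0)" for c
  proof (induction c)
    case 0
    show ?case by (intro bexI[of _ "1\<^sub>m n"]) auto
  next
    case (Suc c)
    then obtain U where U: "U \<in> carrier_mat n n" "\<bar>det U\<bar> = 1"
      "\<forall>i < c. \<forall>j < n. i < j \<longrightarrow> (U * A) $$ (j, i) = 0" by auto
    show ?case
    proof (cases "c < n")
      case True
      have UA: "U * A \<in> carrier_mat n k" using U(1) A by simp
      from unimodular_column_step[OF UA True] Suc.prems
      obtain U' where U': "U' \<in> carrier_mat n n" "\<bar>det U'\<bar> = 1"
        "\<forall>j. c < j \<longrightarrow> j < n \<longrightarrow> (U' * (U * A)) $$ (j, c) = 0"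
        "\<forall>j < c. \<forall>i < k. (U' * (U * A)) $$ (j, i) = (U * A) $$ (j, i)"
        "\<forall>i < k. (\<forall>j \<in> {c..<n}. (U * A) $$ (j, i) = 0) \<longrightarrow> (\<forall>j \<in> {c..<n}. (U' * (U * A)) $$ (j, i) = 0)"
        by auto
      have eq: "(U' * U) * A = U' * (U * A)"
        using U(1) U'(1) A by (intro assoc_mult_mat) auto
      have "\<bar>det (U' * U)\<bar> = 1" using U(1,2) U'(1,2) by (simp add: det_mult[of _ n] abs_mult)
      moreover have "(U' * (U * A)) $$ (j, i) = 0" if ij: "i < Suc c" "j < n" "i < j" for i j
      proof (cases "i = c")
        case False
        then have i: "i < c" "i < k" using ij Suc.prems by auto
        show ?thesis
        \<comment> \<open>An earlier column survives step \<open>c\<close>: its rows above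
          \<open>c\<close> are untouched, and its rows from \<open>c\<close> on were already zero
          and remain so.\<close>
        proof (cases "j < c")
          case True
          then show ?thesis using U'(4) U(3) i ij by simp
        next
          case False
          then show ?thesis using U'(5) U(3) i ij by force
        qed
      qed (use U'(3) ij in blast)
      ultimately show ?thesis
        using U(1) U'(1) by (intro bexI[of _ "U' * U"]) (auto simp: eq)
    next
      \<comment> \<open>Here column \<open>c\<close> has no entries below the diagonal, so the
        previous matrix still works.\<close>
      case False
      then show ?thesis using U by (intro bexI[of _ U]) (auto simp: less_Suc_eq)
    qed
  qed
  then show ?thesis by blast
qed

text \<open>The inverse is the adjugate divided by the determinant; a determinant of 1 or -1 is its
  own inverse, so multiplying by it keeps everything integral.\<close>

lemma unimodular_inverse:
  fixes V :: "int mat"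
  assumes V: "V \<in> carrier_mat n n" and det: "\<bar>det V\<bar> = 1"
  obtains W where "W \<in> carrier_mat n n" "V * W = 1\<^sub>m n" "W * V = 1\<^sub>m n"
proof
  have "det V * det V = 1" using det by (auto simp: abs_if split: if_splits)
  then have sq: "det V \<cdot>\<^sub>m (det V \<cdot>\<^sub>m 1\<^sub>m n) = 1\<^sub>m n"
    by (intro eq_matI) (auto simp: mult.assoc[symmetric])
  let ?W = "det V \<cdot>\<^sub>m adj_mat V"
  note adj = adj_mat[OF V]
  show "?W \<in> carrier_mat n n" using adj(1) by simp
  have "V * ?W = det V \<cdot>\<^sub>m (V * adj_mat V)" using V adj(1) by (rule mult_smult_distrib)
  then show "V * ?W = 1\<^sub>m n" using sq by (simp add: adj(2))
  have "?W * V = det V \<cdot>\<^sub>m (adj_mat V * V)" using adj(1) V by (rule mult_smult_assoc_mat)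
  then show "?W * V = 1\<^sub>m n" using sq by (simp add: adj(3))
qed

section \<open>Blocks of rows and columns, and the factorization of an integer matrix\<close>

definition first_rows :: "nat \<Rightarrow> 'a mat \<Rightarrow> 'a mat" where
  "first_rows k A = mat k (dim_col A) (\<lambda>(i, j). A $$ (i, j))"

definition first_cols :: "nat \<Rightarrow> 'a mat \<Rightarrow> 'a mat" where
  "first_cols k A = mat (dim_row A) k (\<lambda>(i, j). A $$ (i, j))"

definition last_cols :: "nat \<Rightarrow> 'a mat \<Rightarrow> 'a mat" where
  "last_cols k A = mat (dim_row A) (dim_col A - k) (\<lambda>(i, j). A $$ (i, k + j))"

lemma first_rows_carrier [simp]: "A \<in> carrier_mat r n \<Longrightarrow> first_rows k A \<in> carrier_mat k n"
  and first_cols_carrier [simp]: "A \<in> carrier_mat r n \<Longrightarrow> first_cols k A \<in> carrier_mat r k"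
  and last_cols_carrier [simp]: "A \<in> carrier_mat r (k + m) \<Longrightarrow> last_cols k A \<in> carrier_mat r m"
  by (auto simp: first_rows_def first_cols_def last_cols_def)

lemma first_rows_mult:
  assumes "A \<in> carrier_mat (k + m) n" "B \<in> carrier_mat n c"
  shows "first_rows k (A * B) = first_rows k A * B"
  using assms by (intro eq_matI) (auto simp: first_rows_def scalar_prod_def)

text \<open>Supplies a right inverse of \<open>first_rows k W\<close> over the same ring; over the
  integers this is what forces the maximal minors of \<open>first_rows k W\<close> to be
  coprime.\<close>

lemma first_rows_mult_first_cols:
  assumes "A \<in> carrier_mat (k + m) n" "B \<in> carrier_mat n (k + m)" "A * B = 1\<^sub>m (k + m)"
  shows "first_rows k A * first_cols k B = 1\<^sub>m k"
proof (rule eq_matI)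
  fix i j assume "i < dim_row (1\<^sub>m k :: 'a mat)" "j < dim_col (1\<^sub>m k :: 'a mat)"
  then have ij: "i < k" "j < k" by auto
  then have "(first_rows k A * first_cols k B) $$ (i, j) = (A * B) $$ (i, j)"
    using assms(1,2) by (auto simp: first_rows_def first_cols_def scalar_prod_def)
  then show "(first_rows k A * first_cols k B) $$ (i, j) = (1\<^sub>m k :: 'a mat) $$ (i, j)"
    using ij assms(3) by simp
qed (auto simp: first_rows_def first_cols_def)

lemma map_mat_first_rows: "k \<le> dim_row A \<Longrightarrow> map_mat f (first_rows k A) = first_rows k (map_mat f A)"
  by (intro eq_matI) (auto simp: first_rows_def)

lemma last_cols_mult:
  assumes "A \<in> carrier_mat r n" "B \<in> carrier_mat n (k + m)"
  shows "last_cols k (A * B) = A * last_cols k B"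
  using assms by (intro eq_matI) (auto simp: last_cols_def scalar_prod_def)

lemma map_mat_last_cols: "map_mat f (last_cols k A) = last_cols k (map_mat f A)"
  by (intro eq_matI) (auto simp: last_cols_def)

text \<open>Padding with zeros replaces the rectangular block by the whole square matrix, whose
  inverse can then be applied.\<close>

lemma last_cols_mult_vec:
  fixes A :: "'a :: comm_ring_1 mat"
  assumes "A \<in> carrier_mat r (k + m)" "y \<in> carrier_vec m"
  shows "last_cols k A *\<^sub>v y = A *\<^sub>v (0\<^sub>v k @\<^sub>v y)"
proof (rule eq_vecI)
  fix i assume "i < dim_vec (A *\<^sub>v (0\<^sub>v k @\<^sub>v y))"
  then have i: "i < r" using assms by simp
  have "(A *\<^sub>v (0\<^sub>v k @\<^sub>v y)) $ i = (\<Sum>l = 0..<k + m. A $$ (i, l) * (0\<^sub>v k @\<^sub>v y) $ l)"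
    using assms i by (auto simp: scalar_prod_def intro!: sum.cong)
  also have "\<dots> = (\<Sum>l = k..<k + m. A $$ (i, l) * (0\<^sub>v k @\<^sub>v y) $ l)"
    using assms by (intro sum.mono_neutral_right) auto
  also have "\<dots> = (\<Sum>l = 0..<m. A $$ (i, k + l) * y $ l)"
    using assms sum.shift_bounds_nat_ivl[of "\<lambda>l. A $$ (i, l) * (0\<^sub>v k @\<^sub>v y) $ l" 0 k m]
    by (simp add: add.commute)
  also have "\<dots> = (last_cols k A *\<^sub>v y) $ i"
    using assms i by (auto simp: last_cols_def scalar_prod_def intro!: sum.cong)
  finally show "(last_cols k A *\<^sub>v y) $ i = (A *\<^sub>v (0\<^sub>v k @\<^sub>v y)) $ i" ..
qed (use assms in \<open>auto simp: last_cols_def\<close>)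

lemma last_cols_kernel:
  fixes V :: "'a :: comm_ring_1 mat"
  assumes V: "V \<in> carrier_mat (k + m) (k + m)" and W: "W \<in> carrier_mat (k + m) (k + m)"
    and WV: "W * V = 1\<^sub>m (k + m)"
    and y: "y \<in> carrier_vec m" and zero: "last_cols k V *\<^sub>v y = 0\<^sub>v (k + m)"
  shows "y = 0\<^sub>v m"
proof -
  let ?z = "0\<^sub>v k @\<^sub>v y"
  have z: "?z \<in> carrier_vec (k + m)" using y by simp
  have "?z = W *\<^sub>v (V *\<^sub>v ?z)"
    using assoc_mult_mat_vec[OF W V z] z WV by simp
  also have "V *\<^sub>v ?z = 0\<^sub>v (k + m)"
    using zero last_cols_mult_vec[OF V y] by simp
  finally have z0: "?z = 0\<^sub>v (k + m)" using W by auto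
  show ?thesis
  proof (rule eq_vecI)
    fix i assume i: "i < dim_vec (0\<^sub>v m :: 'a vec)"
    then have "?z $ (k + i) = 0" using z0 by simp
    then show "y $ i = 0\<^sub>v m $ i" using i y by simp
  qed (use y in simp)
qed

text \<open>Row reduction of the transpose of \<open>B\<close> becomes column reduction of
  \<open>B\<close>: the columns of \<open>B * V\<close> from \<open>k\<close> on vanish. In
  \<open>B = (B * V) * W\<close> only the first \<open>k\<close> rows of \<open>W\<close> then
  matter, and \<open>H\<close> is the block of the first \<open>k\<close> columns of
  \<open>B * V\<close>.\<close>

lemma unimodular_factorization:
  fixes B :: "int mat"
  assumes B: "B \<in> carrier_mat k (k + m)"
  obtains V W H where "V \<in> carrier_mat (k + m) (k + m)" "W \<in> carrier_mat (k + m) (k + m)"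
    "\<bar>det V\<bar> = 1" "V * W = 1\<^sub>m (k + m)" "W * V = 1\<^sub>m (k + m)"
    "H \<in> carrier_mat k k" "B = H * first_rows k W"
proof -
  let ?n = "k + m"
  have BT: "B\<^sup>T \<in> carrier_mat ?n k" using B by simp
  obtain U where U: "U \<in> carrier_mat ?n ?n" "\<bar>det U\<bar> = 1"
    "\<forall>i < k. \<forall>j < ?n. i < j \<longrightarrow> (U * B\<^sup>T) $$ (j, i) = 0"
    using unimodular_row_reduction[OF BT] by blast
  define V where "V = U\<^sup>T"
  have V: "V \<in> carrier_mat ?n ?n" "\<bar>det V\<bar> = 1"
    using U det_transpose[OF U(1)] by (auto simp: V_def)
  obtain W where W: "W \<in> carrier_mat ?n ?n" "V * W = 1\<^sub>m ?n" "W * V = 1\<^sub>m ?n"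
    using unimodular_inverse[OF V] .
  have BV: "B * V \<in> carrier_mat k ?n" using B V by simp
  have "B * V = (U * B\<^sup>T)\<^sup>T" using transpose_mult[OF U(1) BT] by (simp add: V_def)
  \<comment> \<open>The reduction kills the entries with row index below column index;
    \<open>i < k\<close> and \<open>k \<le> j\<close> place the entry there.\<close>
  then have zero: "(B * V) $$ (i, j) = 0" if "i < k" "j < ?n" "k \<le> j" for i j
    using U(1,3) B that by simp
  have "B = (B * V) * W" using assoc_mult_mat[OF B V(1) W(1)] W(2) B by simp
  also have "\<dots> = first_cols k (B * V) * first_rows k W"
  proof (rule eq_matI)
    fix i j assume "i < dim_row (first_cols k (B * V) * first_rows k W)"
      "j < dim_col (first_cols k (B * V) * first_rows k W)"
    then have ij: "i < k" "j < ?n" using BV W(1) B by (auto simp: first_cols_def first_rows_def)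
    have "((B * V) * W) $$ (i, j) = (\<Sum>l = 0..<?n. (B * V) $$ (i, l) * W $$ (l, j))"
      using ij BV W(1) by (subst index_mult_mat) (auto simp: scalar_prod_def simp del: index_mult_mat intro!: sum.cong)
    also have "\<dots> = (\<Sum>l = 0..<k. (B * V) $$ (i, l) * W $$ (l, j))"
      using ij zero by (intro sum.mono_neutral_right) (auto simp del: index_mult_mat)
    also have "\<dots> = (first_cols k (B * V) * first_rows k W) $$ (i, j)"
      using ij B V W(1) by (auto simp: scalar_prod_def first_cols_def first_rows_def intro!: sum.cong)
    finally show "((B * V) * W) $$ (i, j) = (first_cols k (B * V) * first_rows k W) $$ (i, j)" .
  qed (use B V W in \<open>auto simp: first_cols_def first_rows_def\<close>)
  finally show thesis using that V W first_cols_carrier[OF BV, of k] by blast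
qed

text \<open>A nonzero determinant makes \<open>H\<close> injective, so \<open>x\<close> is in the
  kernel exactly when \<open>W *\<^sub>v x\<close> starts with \<open>k\<close> zeros, that is, when
  \<open>x\<close> is \<open>V\<close> applied to a zero-padded \<open>y\<close>. Since
  \<open>W\<close> has entries in the ring, so has \<open>y\<close>: over the integers this
  parametrizes the integral kernel itself and not merely its rational span.\<close>

lemma kernel_eq_last_cols:
  fixes H :: "'a :: idom mat"
  assumes V: "V \<in> carrier_mat (k + m) (k + m)" and W: "W \<in> carrier_mat (k + m) (k + m)"
    and VW: "V * W = 1\<^sub>m (k + m)" and WV: "W * V = 1\<^sub>m (k + m)"
    and H: "H \<in> carrier_mat k k" and det: "det H \<noteq> 0"
  shows "{x \<in> carrier_vec (k + m). (H * first_rows k W) *\<^sub>v x = 0\<^sub>v k} =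
    {last_cols k V *\<^sub>v y | y. y \<in> carrier_vec m}"
proof -
  let ?n = "k + m"
  let ?W1 = "first_rows k W"
  have W1: "?W1 \<in> carrier_mat k ?n" using W by simp
  have W1x: "(?W1 *\<^sub>v x) $ i = (W *\<^sub>v x) $ i" if "i < k" for x i
  proof -
    have "row ?W1 i = row W i" using W that by (intro eq_vecI) (auto simp: first_rows_def)
    then show ?thesis using W carrier_matD(1)[OF W1] that by simp
  qed
  show ?thesis
  proof (intro equalityI subsetI)
    fix x assume "x \<in> {x \<in> carrier_vec ?n. (H * ?W1) *\<^sub>v x = 0\<^sub>v k}"
    then have x: "x \<in> carrier_vec ?n" and Hx: "(H * ?W1) *\<^sub>v x = 0\<^sub>v k" by auto
    have "H *\<^sub>v (?W1 *\<^sub>v x) = 0\<^sub>v k" using Hx assoc_mult_mat_vec[OF H W1 x] by simp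
    moreover have "?W1 *\<^sub>v x \<in> carrier_vec k" using W1 x by (rule mult_mat_vec_carrier)
    ultimately have W1x0: "?W1 *\<^sub>v x = 0\<^sub>v k"
      using det_0_iff_vec_prod_zero[OF H] det by blast
    define y where "y = vec m (\<lambda>i. (W *\<^sub>v x) $ (k + i))"
    have y: "y \<in> carrier_vec m" by (simp add: y_def)
    have "W *\<^sub>v x = 0\<^sub>v k @\<^sub>v y"
    proof (rule eq_vecI)
      fix i assume "i < dim_vec (0\<^sub>v k @\<^sub>v y)"
      then have i: "i < k + m" by (simp add: y_def)
      show "(W *\<^sub>v x) $ i = (0\<^sub>v k @\<^sub>v y) $ i"
      proof (cases "i < k")
        case True
        then show ?thesis using W1x[OF True, of x] W1x0 i y by simp
      next
        case False
        then show ?thesis using i y by (simp add: y_def)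
      qed
    qed (use W in \<open>simp add: y_def\<close>)
    then have "last_cols k V *\<^sub>v y = V *\<^sub>v (W *\<^sub>v x)" using last_cols_mult_vec[OF V y] by simp
    also have "\<dots> = x" using assoc_mult_mat_vec[OF V W x] VW x by simp
    finally show "x \<in> {last_cols k V *\<^sub>v y | y. y \<in> carrier_vec m}" using y by auto
  next
    fix x assume "x \<in> {last_cols k V *\<^sub>v y | y. y \<in> carrier_vec m}"
    then obtain y where y: "y \<in> carrier_vec m" and x: "x = V *\<^sub>v (0\<^sub>v k @\<^sub>v y)"
      using last_cols_mult_vec[OF V] by auto
    have xc: "x \<in> carrier_vec ?n" unfolding x using V y by (intro mult_mat_vec_carrier) auto
    have "W *\<^sub>v x = 0\<^sub>v k @\<^sub>v y"
      using assoc_mult_mat_vec[OF W V, of "0\<^sub>v k @\<^sub>v y"] WV x y by simp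
    then have "?W1 *\<^sub>v x = 0\<^sub>v k"
      using W1x[of _ x] carrier_matD(1)[OF W1] y by (intro eq_vecI) (auto simp del: index_mult_mat_vec)
    then have "(H * ?W1) *\<^sub>v x = 0\<^sub>v k" using assoc_mult_mat_vec[OF H W1 xc] H by auto
    then show "x \<in> {x \<in> carrier_vec ?n. (H * ?W1) *\<^sub>v x = 0\<^sub>v k}" using xc by simp
  qed
qed

section \<open>Gram determinants and minors\<close>

text \<open>Jacobi's identity for complementary minors of inverse matrices, in the case of the
  leading and trailing blocks.\<close>

lemma det_complementary_block:
  fixes M N :: "'a :: idom mat"
  assumes M: "M \<in> carrier_mat (k + m) (k + m)" and N: "N \<in> carrier_mat (k + m) (k + m)"
    and MN: "M * N = 1\<^sub>m (k + m)"
  shows "det (mat m m (\<lambda>(i, j). M $$ (k + i, k + j))) = det M * det (mat k k (\<lambda>(i, j). N $$ (i, j)))"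
proof -
  let ?n = "k + m"
  let ?N1 = "mat k k (\<lambda>(i, j). N $$ (i, j))" and ?N3 = "mat m k (\<lambda>(i, j). N $$ (k + i, j))"
  let ?M2 = "mat k m (\<lambda>(i, j). M $$ (i, k + j))" and ?M4 = "mat m m (\<lambda>(i, j). M $$ (k + i, k + j))"
  \<comment> \<open>\<open>?P\<close> is the identity with its first \<open>k\<close> columns
    replaced by those of \<open>N\<close>. Multiplying by \<open>M\<close> turns these into unit
    vectors and the others into columns of \<open>M\<close>, which gives \<open>?Q\<close>; both are
    block triangular.\<close>
  let ?P = "four_block_mat ?N1 (0\<^sub>m k m) ?N3 (1\<^sub>m m)"
  let ?Q = "four_block_mat (1\<^sub>m k) ?M2 (0\<^sub>m m k) ?M4"
  have P: "?P \<in> carrier_mat ?n ?n" by auto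
  have "M * ?P = ?Q"
  proof (rule eq_matI)
    fix i j assume "i < dim_row ?Q" "j < dim_col ?Q"
    then have ij: "i < ?n" "j < ?n" by auto
    show "(M * ?P) $$ (i, j) = ?Q $$ (i, j)"
    proof (cases "j < k")
      case True
      have "col ?P j = col N j" using True ij N by (intro eq_vecI) auto
      then have "(M * ?P) $$ (i, j) = (M * N) $$ (i, j)" using ij M N by simp
      then show ?thesis using True ij by (auto simp: MN)
    next
      case False
      have "col ?P j = unit_vec ?n j" using False ij by (intro eq_vecI) auto
      then have "(M * ?P) $$ (i, j) = M $$ (i, j)" using ij M by simp
      then show ?thesis using False ij by auto
    qed
  qed (use M in auto)
  then have "det M * det ?P = det ?Q" using det_mult[OF M P] by simp
  also have "det ?P = det ?N1"
    by (subst det_four_block_mat_upper_right_zero[of _ k _ m]) auto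
  also have "det ?Q = det ?M4"
    by (subst det_four_block_mat_lower_left_zero[of _ k _ m]) auto
  finally show ?thesis ..
qed

text \<open>The Gram matrix of the last columns of \<open>X\<close> is the trailing block of
  \<open>X\<^sup>T * X\<close>, that of the first rows of \<open>Y\<close> is the leading block of
  \<open>Y * Y\<^sup>T\<close>, and these two products are mutually inverse.\<close>

lemma det_gram_complementary:
  fixes X Y :: "'a :: idom mat"
  assumes X: "X \<in> carrier_mat (k + m) (k + m)" and Y: "Y \<in> carrier_mat (k + m) (k + m)"
    and XY: "X * Y = 1\<^sub>m (k + m)" and YX: "Y * X = 1\<^sub>m (k + m)"
  shows "det ((last_cols k X)\<^sup>T * last_cols k X) =
    (det X)\<^sup>2 * det (first_rows k Y * (first_rows k Y)\<^sup>T)"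
proof -
  let ?n = "k + m"
  have M: "X\<^sup>T * X \<in> carrier_mat ?n ?n" and N: "Y * Y\<^sup>T \<in> carrier_mat ?n ?n"
    and XT: "X\<^sup>T \<in> carrier_mat ?n ?n" and YT: "Y\<^sup>T \<in> carrier_mat ?n ?n" using X Y by auto
  have "X\<^sup>T * X * (Y * Y\<^sup>T) = X\<^sup>T * (X * (Y * Y\<^sup>T))" by (rule assoc_mult_mat[OF XT X N])
  also have "X * (Y * Y\<^sup>T) = (X * Y) * Y\<^sup>T" by (rule assoc_mult_mat[OF X Y YT, symmetric])
  also have "\<dots> = Y\<^sup>T" using XY YT by simp
  also have "X\<^sup>T * Y\<^sup>T = (Y * X)\<^sup>T" by (rule transpose_mult[OF Y X, symmetric])
  finally have MN: "X\<^sup>T * X * (Y * Y\<^sup>T) = 1\<^sub>m ?n" using YX by simp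
  have "(last_cols k X)\<^sup>T * last_cols k X = mat m m (\<lambda>(i, j). (X\<^sup>T * X) $$ (k + i, k + j))"
    using X by (intro eq_matI) (auto simp: last_cols_def scalar_prod_def)
  moreover have "first_rows k Y * (first_rows k Y)\<^sup>T = mat k k (\<lambda>(i, j). (Y * Y\<^sup>T) $$ (i, j))"
    using Y by (intro eq_matI) (auto simp: first_rows_def scalar_prod_def)
  moreover have "det (X\<^sup>T * X) = (det X)\<^sup>2"
    using X by (simp add: det_mult[OF XT X] det_transpose[OF X] power2_eq_square)
  ultimately show ?thesis using det_complementary_block[OF M N MN] by simp
qed

section \<open>Maximal minors of products and their greatest common divisor\<close>

lemma det_submatrix_mult_left:
  fixes H A :: "'a :: comm_ring_1 mat"
  assumes H: "H \<in> carrier_mat k k" and A: "A \<in> carrier_mat k n"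
    and I: "I \<subseteq> {..<n}" "card I = k"
  shows "det (submatrix (H * A) UNIV I) = det H * det (submatrix A UNIV I)"
proof -
  have HA: "H * A \<in> carrier_mat k n" using H A by simp
  have pick: "pick I j < n" if "j < k" for j using pick_in_set[of j I] that I by auto
  have "submatrix (H * A) UNIV I = H * submatrix A UNIV I"
    unfolding submatrix_UNIV_left[OF HA I(1)] submatrix_UNIV_left[OF A I(1)] I(2)
    using H A pick by (intro eq_matI) (auto simp: scalar_prod_def)
  then show ?thesis
    using det_mult[OF H, of "submatrix A UNIV I"] submatrix_UNIV_left[OF A I(1)] I(2) by simp
qed

lemma det_mat_diag: "det (mat_diag n d) = (\<Prod>i<n. d i :: 'a :: comm_ring_1)"
  by (subst det_upper_triangular[of _ n])
    (auto simp: mat_diag_def prod_list_diag_prod atLeast0LessThan)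

lemma det_submatrix_mult_diag:
  fixes A :: "'a :: comm_ring_1 mat"
  assumes A: "A \<in> carrier_mat k n" and I: "I \<subseteq> {..<n}" "card I = k"
  shows "det (submatrix (A * mat_diag n d) UNIV I) = det (submatrix A UNIV I) * (\<Prod>i\<in>I. d i)"
proof -
  have AD: "A * mat_diag n d \<in> carrier_mat k n" using A by (simp add: mat_diag_def)
  have sub: "submatrix A UNIV I \<in> carrier_mat k k"
    using submatrix_UNIV_left[OF A I(1)] I(2) by simp
  \<comment> \<open>Selecting columns after scaling equals scaling the selected columns by the
    selected weights.\<close>
  let ?E = "mat_diag k (\<lambda>j. d (pick I j))"
  have pick: "pick I j < n" if "j < k" for j using pick_in_set[of j I] that I by auto
  have "submatrix (A * mat_diag n d) UNIV I = submatrix A UNIV I * ?E"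
    unfolding mat_diag_mult_right[OF sub] submatrix_UNIV_left[OF AD I(1)]
    unfolding submatrix_UNIV_left[OF A I(1)] mat_diag_mult_right[OF A] I(2)
    using pick by (intro eq_matI) auto
  moreover have "det ?E = (\<Prod>j = 0..<k. d (pick I j))"
    by (simp add: det_mat_diag atLeast0LessThan)
  moreover have "\<dots> = (\<Prod>i\<in>I. d i)"
    using prod.reindex_bij_betw[OF bij_betw_pick, of I d] I finite_subset by auto
  ultimately show ?thesis using det_mult[OF sub, of ?E] by simp
qed

text \<open>\<open>det H\<close> divides every minor of \<open>H * A\<close> because it factors out.
  Conversely \<open>H * A * A' = H\<close>, and Cauchy-Binet writes \<open>det H\<close> as an
  integer combination of these minors.\<close>

lemma Gcd_minors_eq:
  fixes H A A' :: "int mat"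
  assumes H: "H \<in> carrier_mat k k" and A: "A \<in> carrier_mat k n"
    and A': "A' \<in> carrier_mat n k" and AA': "A * A' = 1\<^sub>m k"
  shows "Gcd {det (submatrix (H * A) UNIV I) | I. I \<subseteq> {..<n} \<and> card I = k} = \<bar>det H\<bar>"
    (is "Gcd ?M = _")
proof -
  have "Gcd ?M dvd (\<Sum>I | I \<subseteq> {..<n} \<and> card I = k.
      det (submatrix (H * A) UNIV I) * det (submatrix A' I UNIV))"
    by (intro dvd_sum dvd_mult2 Gcd_dvd) auto
  also have "\<dots> = det (H * A * A')"
    using H A by (intro cauchy_binet[symmetric] A') simp
  also have "H * A * A' = H" using assoc_mult_mat[OF H A A'] AA' H by simp
  finally have "Gcd ?M dvd det H" .
  moreover have "det H dvd Gcd ?M"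
    by (rule Gcd_greatest) (auto simp: det_submatrix_mult_left[OF H A])
  ultimately have "\<bar>Gcd ?M\<bar> = \<bar>det H\<bar>" by (simp add: zdvd_antisym_abs)
  then show ?thesis by simp
qed

section \<open>From lattices to matrices\<close>

lemma orth_lattice_eq_kernel:
  assumes B: "B \<in> carrier_mat k n" and basis: "is_int_basis_matrix n B \<Lambda>"
  shows "orth_lattice n \<Lambda> = {x \<in> carrier_vec n. B *\<^sub>v x = 0\<^sub>v k}"
proof -
  let ?Q = "map_mat rat_of_int B"
  have Q: "?Q \<in> carrier_mat k n" using B by simp
  have rows: "set (rows ?Q) = {row ?Q i | i. i < k}"
    using B by (auto simp: rows_def)
  \<comment> \<open>Being orthogonal to the row space means being orthogonal to each row, and for
    integral \<open>x\<close> these pairings are the entries of \<open>B *\<^sub>v x\<close>. The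
    rational condition thus becomes an integral linear system.\<close>
  have "vec_module.orthogonal_complement n (rat_space n \<Lambda>) =
      vec_module.orthogonal_complement n (set (rows ?Q))"
    unfolding rat_space_eq[OF basis] vec_space.row_space_def
    using Q rows_carrier[of ?Q] by (intro vec_space.in_orthogonal_complement_span) auto
  moreover have "map_vec rat_of_int x \<in> vec_module.orthogonal_complement n (set (rows ?Q)) \<longleftrightarrow>
      B *\<^sub>v x = 0\<^sub>v k" if x: "x \<in> carrier_vec n" for x
  proof -
    have "map_vec rat_of_int x \<bullet> row ?Q i = rat_of_int ((B *\<^sub>v x) $ i)" if "i < k" for i
      using that B x by (simp add: scalar_prod_def mult.commute)
    then have "map_vec rat_of_int x \<in> vec_module.orthogonal_complement n (set (rows ?Q)) \<longleftrightarrow>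
        (\<forall>i < k. (B *\<^sub>v x) $ i = 0)"
      unfolding vec_module.orthogonal_complement_def rows
      using x by (auto simp del: index_mult_mat_vec)
    also have "\<dots> \<longleftrightarrow> B *\<^sub>v x = 0\<^sub>v k"
      using B by (auto simp: vec_eq_iff)
    finally show ?thesis .
  qed
  ultimately show ?thesis unfolding orth_lattice_def by auto
qed

text \<open>A trivial kernel yields both requirements on a basis matrix. Distinctness is a separate
  point because independence of the set of columns does not see repetitions; equal columns
  \<open>i\<close> and \<open>j\<close> would put the difference of two unit vectors into the
  kernel.\<close>

lemma is_basis_matrix_transpose:
  fixes M :: "real mat"
  assumes M: "M \<in> carrier_mat n m"
    and ker: "\<And>y. y \<in> carrier_vec m \<Longrightarrow> M *\<^sub>v y = 0\<^sub>v n \<Longrightarrow> y = 0\<^sub>v m"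
  shows "is_basis_matrix n M\<^sup>T {M *\<^sub>v map_vec real_of_int y | y. y \<in> carrier_vec m}"
proof -
  have dist: "distinct (cols M)"
  proof (rule ccontr)
    assume "\<not> distinct (cols M)"
    then obtain i j where ij: "i < m" "j < m" "i \<noteq> j" "col M i = col M j"
      using M by (auto simp: distinct_conv_nth)
    let ?y = "unit_vec m i - unit_vec m j :: real vec"
    have unit: "M *\<^sub>v unit_vec m l = col M l" if "l < m" for l
      using M that by (intro eq_vecI) auto
    have "M *\<^sub>v ?y = M *\<^sub>v unit_vec m i - M *\<^sub>v unit_vec m j"
      using M by (intro mult_minus_distrib_mat_vec) auto
    also have "\<dots> = col M i - col M j"
      using unit ij by simp
    also have "\<dots> = 0\<^sub>v n" using M ij by simp
    finally have "?y = 0\<^sub>v m" by (intro ker) auto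
    moreover have "?y $ i = 1" using ij by simp
    ultimately show False using ij by simp
  qed
  have "module.lin_indpt class_ring (module_vec TYPE(real) n) (set (cols M))"
  proof
    assume "module.lin_dep class_ring (module_vec TYPE(real) n) (set (cols M))"
    then obtain v where "v \<in> carrier_vec m" "v \<noteq> 0\<^sub>v m" "M *\<^sub>v v = 0\<^sub>v n"
      using vec_space.lin_depE[OF M _ dist] by blast
    then show False using ker by blast
  qed
  then show ?thesis using M dist by (simp add: is_basis_matrix_def)
qed

text \<open>Justifies writing \<open>n = k + m\<close>. Distinctness identifies the number of rows
  with the size of the independent set they form.\<close>

lemma is_int_basis_matrix_dim_le:
  assumes B: "B \<in> carrier_mat k n" and basis: "is_int_basis_matrix n B \<Lambda>"
  shows "k \<le> n"
proof -
  interpret vec_space "TYPE(real)" n .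
  let ?R = "map_mat real_of_int B"
  have "distinct (rows ?R)" "lin_indpt (set (rows ?R))"
    using basis by (auto simp: is_int_basis_matrix_def is_basis_matrix_def)
  moreover have "set (rows ?R) \<subseteq> carrier_vec n" using rows_carrier[of ?R] B by simp
  ultimately have "card (set (rows ?R)) \<le> dim" using li_le_dim(2)[OF fin_dim] by simp
  then show ?thesis using \<open>distinct (rows ?R)\<close> B by (simp add: distinct_card dim_is_n)
qed

lemma det_submatrix_map_mat_of_int:
  assumes B: "B \<in> carrier_mat k n" and I: "I \<subseteq> {..<n}" "card I = k"
  shows "det (submatrix (map_mat real_of_int B) UNIV I) = real_of_int (det (submatrix B UNIV I))"
proof -
  have pick: "pick I j < n" if "j < k" for j using pick_in_set[of j I] that I by auto
  have RB: "map_mat real_of_int B \<in> carrier_mat k n" using B by simp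
  have "submatrix (map_mat real_of_int B) UNIV I = map_mat real_of_int (submatrix B UNIV I)"
    unfolding submatrix_UNIV_left[OF RB I(1)] submatrix_UNIV_left[OF B I(1)] I(2)
    using B pick by (intro eq_matI) auto
  then show ?thesis by simp
qed

text \<open>Cauchy-Binet for \<open>A\<close> and its transpose: the two minors belonging to
  \<open>I\<close> agree, and scaling the columns divides the minor of \<open>B\<close> by the
  weights in \<open>I\<close>.\<close>

lemma det_gram_weighted_eq_sum_minors:
  fixes B :: "int mat" and S :: "nat \<Rightarrow> real"
  assumes B: "B \<in> carrier_mat k n"
  defines "A \<equiv> map_mat real_of_int B * mat_diag n (\<lambda>i. 1 / S i)"
  shows "det (A * A\<^sup>T) = (\<Sum>I | I \<subseteq> {..<n} \<and> card I = k.
           (real_of_int (det (submatrix B UNIV I)) / (\<Prod>i\<in>I. S i))\<^sup>2)"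
proof -
  have RB: "map_mat real_of_int B \<in> carrier_mat k n" using B by simp
  have A: "A \<in> carrier_mat k n" using RB by (simp add: A_def mat_diag_def)
  have AT: "A\<^sup>T \<in> carrier_mat n k" using A by simp
  show ?thesis unfolding cauchy_binet[OF A AT]
  proof (rule sum.cong[OF refl])
    fix I assume "I \<in> {I. I \<subseteq> {..<n} \<and> card I = k}"
    then have I: "I \<subseteq> {..<n}" "card I = k" by auto
    have pick: "pick I j < n" if "j < k" for j using pick_in_set[of j I] that I by auto
    have sub: "submatrix A UNIV I \<in> carrier_mat k k"
      using submatrix_UNIV_left[OF A I(1)] I(2) by simp
    have "submatrix A\<^sup>T I UNIV = (submatrix A UNIV I)\<^sup>T"
      unfolding submatrix_UNIV_left[OF A I(1)] submatrix_UNIV_right[OF AT I(1)] I(2)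
      using A pick by (intro eq_matI) auto
    then have "det (submatrix A\<^sup>T I UNIV) = det (submatrix A UNIV I)"
      using det_transpose[OF sub] by simp
    moreover have "det (submatrix A UNIV I) = real_of_int (det (submatrix B UNIV I)) / (\<Prod>i\<in>I. S i)"
      unfolding A_def
      by (simp add: det_submatrix_mult_diag[OF RB I] det_submatrix_map_mat_of_int[OF B I] prod_dividef)
    ultimately show "det (submatrix A UNIV I) * det (submatrix A\<^sup>T I UNIV) =
        (real_of_int (det (submatrix B UNIV I)) / (\<Prod>i\<in>I. S i))\<^sup>2"
      by (simp add: power2_eq_square)
  qed
qed

lemma det_gram_mult_left:
  fixes H A :: "'a :: comm_ring_1 mat"
  assumes H: "H \<in> carrier_mat k k" and A: "A \<in> carrier_mat k n"
  shows "det ((H * A) * (H * A)\<^sup>T) = (det H)\<^sup>2 * det (A * A\<^sup>T)"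
proof -
  have AT: "A\<^sup>T \<in> carrier_mat n k" and HT: "H\<^sup>T \<in> carrier_mat k k"
    and AAT: "A * A\<^sup>T \<in> carrier_mat k k" using H A by auto
  have "(H * A) * (H * A)\<^sup>T = H * (A * (A\<^sup>T * H\<^sup>T))"
    unfolding transpose_mult[OF H A] using H A by (intro assoc_mult_mat) auto
  also have "A * (A\<^sup>T * H\<^sup>T) = (A * A\<^sup>T) * H\<^sup>T" by (rule assoc_mult_mat[OF A AT HT, symmetric])
  finally have "det ((H * A) * (H * A)\<^sup>T) = det H * (det (A * A\<^sup>T) * det H\<^sup>T)"
    using det_mult[OF H mult_carrier_mat[OF AAT HT]] det_mult[OF AAT HT] by simp
  then show ?thesis by (simp add: det_transpose[OF H] power2_eq_square mult_ac)
qed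

text \<open>If \<open>det H\<close> were zero, some nonzero integer vector would be annihilated by
  the transpose of \<open>H\<close>, hence by that of \<open>H * A\<close>. This would be a linear
  relation between the rows of a basis matrix.\<close>

lemma is_int_basis_matrix_factor_det_nonzero:
  assumes H: "H \<in> carrier_mat k k" and A: "A \<in> carrier_mat k n"
    and basis: "is_int_basis_matrix n (H * A) \<Lambda>"
  shows "det H \<noteq> 0"
proof
  assume "det H = 0"
  then have "det H\<^sup>T = 0" using det_transpose[OF H] by simp
  moreover have HT: "H\<^sup>T \<in> carrier_mat k k" and AT: "A\<^sup>T \<in> carrier_mat n k" using H A by auto
  ultimately obtain v where v: "v \<in> carrier_vec k" "v \<noteq> 0\<^sub>v k" "H\<^sup>T *\<^sub>v v = 0\<^sub>v k"
    using det_0_iff_vec_prod_zero by blast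
  let ?R = "map_mat real_of_int (H * A)"
  have HA: "H * A \<in> carrier_mat k n" using H A by simp
  have "(H * A)\<^sup>T *\<^sub>v v = A\<^sup>T *\<^sub>v (H\<^sup>T *\<^sub>v v)"
    unfolding transpose_mult[OF H A] by (rule assoc_mult_mat_vec[OF AT HT v(1)])
  also have "\<dots> = 0\<^sub>v n" using AT v(3) by auto
  finally have "map_vec real_of_int ((H * A)\<^sup>T *\<^sub>v v) = 0\<^sub>v n" by auto
  moreover have "map_vec real_of_int ((H * A)\<^sup>T *\<^sub>v v) = ?R\<^sup>T *\<^sub>v map_vec real_of_int v"
    using of_int_hom.mult_mat_vec_hom[of "(H * A)\<^sup>T" n k v] HA v(1) by (simp add: map_mat_transpose)
  moreover have "dim_row ?R = k" using H by simp
  ultimately have "map_vec real_of_int v = 0\<^sub>v k"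
    using is_basis_matrix_kernel[OF basis[unfolded is_int_basis_matrix_def], of "map_vec real_of_int v"] v(1)
    by (simp only: map_carrier_vec)
  then have "v = 0\<^sub>v k" by (auto simp: vec_eq_iff)
  then show False using v(2) by simp
qed

theorem theorem3p3:
  fixes n k :: nat and \<Lambda> :: "int vec set" and B :: "int mat" and S :: "nat \<Rightarrow> real"
  assumes "B \<in> carrier_mat k n"
    and "is_int_basis_matrix n B \<Lambda>"
    and "\<And>i. i < n \<Longrightarrow> S i \<noteq> 0"
  shows "lattice_det n
           (lattice_transform (map_vec real_of_int ` orth_lattice n \<Lambda>) (mat_diag n S)) =
         \<bar>\<Prod>i<n. S i\<bar> /
           real_of_int (Gcd {det (submatrix B UNIV I) | I. I \<subseteq> {..<n} \<and> card I = k}) *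
         sqrt (\<Sum>I | I \<subseteq> {..<n} \<and> card I = k.
                 (real_of_int (det (submatrix B UNIV I)) / (\<Prod>i\<in>I. S i))\<^sup>2)"
proof -
  note B = assms(1) and basis = assms(2) and S = assms(3)
  let ?R = "map_mat real_of_int" and ?r = "map_vec real_of_int"
  obtain m where n: "n = k + m"
    using is_int_basis_matrix_dim_le[OF B basis] le_Suc_ex by blast
  obtain V W H where V: "V \<in> carrier_mat n n" and W: "W \<in> carrier_mat n n"
    and detV: "\<bar>det V\<bar> = 1" and VW: "V * W = 1\<^sub>m n" and WV: "W * V = 1\<^sub>m n"
    and H: "H \<in> carrier_mat k k" and BH: "B = H * first_rows k W"
    using unimodular_factorization[of B k m] B unfolding n by blast
  have W1: "first_rows k W \<in> carrier_mat k n" using W by simp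
  have detH: "det H \<noteq> 0"
    using is_int_basis_matrix_factor_det_nonzero[OF H W1] basis BH by simp
  have gcd: "Gcd {det (submatrix B UNIV I) | I. I \<subseteq> {..<n} \<and> card I = k} = \<bar>det H\<bar>"
    unfolding BH
    using first_rows_mult_first_cols[of W k m n V] V W WV
    by (intro Gcd_minors_eq[OF H W1 first_cols_carrier[OF V]]) (simp add: n)

  define D where "D = mat_diag n S"
  define D' where "D' = mat_diag n (\<lambda>i. 1 / S i)"
  define X where "X = D * ?R V"
  define Y where "Y = ?R W * D'"
  have D: "D \<in> carrier_mat n n" and D': "D' \<in> carrier_mat n n"
    and RV: "?R V \<in> carrier_mat n n" and RW: "?R W \<in> carrier_mat n n"
    using V W by (auto simp: D_def D'_def)
  have X: "X \<in> carrier_mat n n" and Y: "Y \<in> carrier_mat n n"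
    using D D' RV RW by (auto simp: X_def Y_def)
  \<comment> \<open>Here the weights have to be nonzero.\<close>
  have DD': "D * D' = 1\<^sub>m n" and D'D: "D' * D = 1\<^sub>m n"
    using S unfolding D_def D'_def mat_diag_diag by (auto simp: mat_diag_def intro!: eq_matI)
  have RVW: "?R V * ?R W = 1\<^sub>m n" and RWV: "?R W * ?R V = 1\<^sub>m n"
    using of_int_hom.mat_hom_mult[OF V W, where 'a = real] of_int_hom.mat_hom_mult[OF W V, where 'a = real]
    by (simp_all add: VW WV of_int_hom.mat_hom_one)
  have XY: "X * Y = 1\<^sub>m n"
  proof -
    have "X * Y = D * (?R V * (?R W * D'))"
      unfolding X_def Y_def using D RV RW D' by (intro assoc_mult_mat) auto
    also have "?R V * (?R W * D') = (?R V * ?R W) * D'" by (rule assoc_mult_mat[OF RV RW D', symmetric])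
    finally show ?thesis using RVW DD' D' by simp
  qed
  have YX: "Y * X = 1\<^sub>m n"
  proof -
    have "Y * X = ?R W * (D' * (D * ?R V))"
      unfolding X_def Y_def using D RV RW D' by (intro assoc_mult_mat) auto
    also have "D' * (D * ?R V) = (D' * D) * ?R V" by (rule assoc_mult_mat[OF D' D RV, symmetric])
    finally show ?thesis using RWV D'D RV by simp
  qed

  let ?X2 = "last_cols k X" and ?Y1 = "first_rows k Y"
  have X2: "?X2 \<in> carrier_mat n m" using X n by simp
  have V2: "last_cols k V \<in> carrier_mat n m" using V n by simp
  \<comment> \<open>\<open>lattice_transform\<close> multiplies column vectors by the transpose,
    which for a diagonal matrix is the matrix itself.\<close>
  have DT: "D\<^sup>T = D" by (intro eq_matI) (auto simp: D_def mat_diag_def)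
  have "orth_lattice n \<Lambda> = {last_cols k V *\<^sub>v y | y. y \<in> carrier_vec m}"
    using kernel_eq_last_cols[of V k m W H, folded n, OF V W VW WV H detH]
      orth_lattice_eq_kernel[OF B basis] BH by simp
  moreover have "D *\<^sub>v ?r (last_cols k V *\<^sub>v y) = ?X2 *\<^sub>v ?r y" if y: "y \<in> carrier_vec m" for y
  proof -
    have "?r (last_cols k V *\<^sub>v y) = last_cols k (?R V) *\<^sub>v ?r y"
      using of_int_hom.mult_mat_vec_hom[OF V2 y] by (simp add: map_mat_last_cols)
    moreover have "last_cols k (?R V) \<in> carrier_mat n m" using RV n by simp
    moreover have "?X2 = D * last_cols k (?R V)"
      unfolding X_def using D RV n by (intro last_cols_mult) auto
    ultimately show ?thesis using D y by (simp add: assoc_mult_mat_vec[of _ n n _ m])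
  qed
  ultimately have lat: "lattice_transform (?r ` orth_lattice n \<Lambda>) D = {?X2 *\<^sub>v ?r y | y. y \<in> carrier_vec m}"
    unfolding lattice_transform_def DT by (auto simp: image_def) metis+
  \<comment> \<open>The left inverse \<open>Y\<close> of \<open>X\<close> makes the last columns of
    \<open>X\<close> independent, so they form a basis of the scaled orthogonal lattice and
    \<open>lattice_det_eq\<close> applies to it.\<close>
  have "is_basis_matrix n ?X2\<^sup>T {?X2 *\<^sub>v ?r y | y. y \<in> carrier_vec m}"
    using last_cols_kernel[of X k m Y] X Y YX by (intro is_basis_matrix_transpose[OF X2]) (auto simp: n)
  then have "lattice_det n (lattice_transform (?r ` orth_lattice n \<Lambda>) D) = sqrt (det (?X2\<^sup>T * ?X2))"
    unfolding lat by (simp add: lattice_det_eq)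
  also have "det (?X2\<^sup>T * ?X2) = (det X)\<^sup>2 * det (?Y1 * ?Y1\<^sup>T)"
    using X Y XY YX unfolding n by (rule det_gram_complementary)
  \<comment> \<open>\<open>V\<close> has determinant 1 or -1, which disappears on squaring.\<close>
  also have "(det X)\<^sup>2 = (\<Prod>i<n. S i)\<^sup>2"
  proof -
    have "det X = (\<Prod>i<n. S i) * real_of_int (det V)"
      unfolding X_def det_mult[OF D RV] by (simp add: D_def det_mat_diag)
    moreover have "(real_of_int (det V))\<^sup>2 = 1"
      using detV by (metis abs_1 of_int_1 of_int_abs power2_abs power_one)
    ultimately show ?thesis by (simp add: power_mult_distrib)
  qed
  finally have lhs: "lattice_det n (lattice_transform (?r ` orth_lattice n \<Lambda>) D) =
      \<bar>\<Prod>i<n. S i\<bar> * sqrt (det (?Y1 * ?Y1\<^sup>T))"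
    by (simp add: real_sqrt_mult)

  have Y1: "?Y1 \<in> carrier_mat k n" using Y by simp
  have RH: "?R H \<in> carrier_mat k k" and RW1: "first_rows k (?R W) \<in> carrier_mat k n"
    using H RW by auto
  have "?Y1 = first_rows k (?R W) * D'"
    unfolding Y_def using RW D' n by (intro first_rows_mult[of _ k m n]) auto
  moreover have "?R B = ?R H * first_rows k (?R W)"
    unfolding BH using of_int_hom.mat_hom_mult[OF H W1] W n by (simp add: map_mat_first_rows)
  \<comment> \<open>The scaled matrix \<open>B\<close> and the rows \<open>?Y1\<close> differ only
    by the factor \<open>H\<close>, so the sum of squared weighted minors is the Gram determinant on
    the left-hand side times the square of \<open>det H\<close>.\<close>
  ultimately have BD: "?R B * D' = ?R H * ?Y1"
    using assoc_mult_mat[OF RH RW1 D'] by simp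
  have "(\<Sum>I | I \<subseteq> {..<n} \<and> card I = k.
      (real_of_int (det (submatrix B UNIV I)) / (\<Prod>i\<in>I. S i))\<^sup>2) = det ((?R B * D') * (?R B * D')\<^sup>T)"
    unfolding D'_def by (rule det_gram_weighted_eq_sum_minors[OF B, symmetric])
  also have "\<dots> = (real_of_int (det H))\<^sup>2 * det (?Y1 * ?Y1\<^sup>T)"
    unfolding BD det_gram_mult_left[OF RH Y1] by simp
  finally have rhs: "sqrt (\<Sum>I | I \<subseteq> {..<n} \<and> card I = k.
      (real_of_int (det (submatrix B UNIV I)) / (\<Prod>i\<in>I. S i))\<^sup>2) =
      \<bar>real_of_int (det H)\<bar> * sqrt (det (?Y1 * ?Y1\<^sup>T))"
    by (simp add: real_sqrt_mult)
  \<comment> \<open>On the right the factor \<open>\<bar>det H\<bar>\<close> from the minors cancels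
    against the greatest common divisor, which equals it and is nonzero.\<close>
  show ?thesis
    using lhs detH unfolding rhs gcd D_def by simp
qed

end
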